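(* Let $n$ be a positive integer with $\omega(n)\ge 2$. Then $\tilde{\Gamma}_{\mathcal{H}}(\mathbb{Z}_n)$ is a hypertree if and only if $n=p_1^{\alpha_1}p_2$ or $n=p_1p_2p_3$, for some distinct primes $p_1,p_2,p_3$ and some integer $\alpha_1\ge 1$.
   Context: $\omega(n)$ denotes the number of distinct prime divisors of $n$. A hypergraph is a pair $(V,E)$ with $E$ a set of subsets of $V$ (hyperedges). For a group $G$ with identity $e$, let $S$ be the set of all non-trivial proper subgroups of $G$. The intersection hypergraph $\tilde{\Gamma}_{\mathcal{H}}(G)$ has vertex set $V=\{H\in S : H\cap K=\{e\}\text{ for some }K\in S\}$, and $E\subseteq V$ is a hyperedge if and only if (1) for distinct $H,K\in E$, $H\cap K=\{e\}$; and (2) there is no $E'\subseteq V$ with $E'\supsetneq E$ satisfying (1). A host graph for a hypergraph is a connected graph on the same vertex set such that every hyperedge induces a connected subgraph of it. A hypergraph $\mathcal{H}=(X,\mathcal{D})$ is called a hypertree if there exists a host tree $T=(X,E)$, i.e. a tree on the vertex set $X$ such that each hyperedge $D\in\mathcal{D}$ induces a subtree of $T$. *)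

theory Defs
  imports
    "Graph_Theory.Graph_Theory"
    "HOL-Algebra.Elementary_Groups"
    "HOL-Computational_Algebra.Primes"
begin

text \<open>
  Undirected simple graphs are symmetric loop-free digraphs without parallel arcs.
  The library's \<open>tree\<close> does not describe undirected trees: it forbids all directed cycles,
  and in a symmetric digraph every edge already yields the directed cycle \<open>u, v, u\<close>.
  The cycles of the undirected graph are the directed cycles of length at least three.
\<close>

definition undirected_tree :: "('v, 'e) pre_digraph \<Rightarrow> bool" where
  "undirected_tree T \<longleftrightarrow>
     sym_digraph T \<and> loopfree_digraph T \<and> nomulti_digraph T \<and>
     Digraph_Component.connected T \<and>
     \<not> (\<exists>p. pre_digraph.cycle T p \<and> 3 \<le> length p)"

type_synonym 'v hypergraph = "'v set \<times> 'v set set"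

definition wf_hypergraph :: "'v hypergraph \<Rightarrow> bool" where
  "wf_hypergraph \<H> \<longleftrightarrow> (\<forall>D \<in> snd \<H>. D \<subseteq> fst \<H>)"

definition host_tree :: "'v pair_pre_digraph \<Rightarrow> 'v hypergraph \<Rightarrow> bool" where
  "host_tree T \<H> \<longleftrightarrow>
     pverts T = fst \<H> \<and> undirected_tree (with_proj T) \<and>
     (\<forall>D \<in> snd \<H>. undirected_tree (induce_subgraph (with_proj T) D))"

definition hypertree :: "'v hypergraph \<Rightarrow> bool" where
  "hypertree \<H> \<longleftrightarrow> wf_hypergraph \<H> \<and> (\<exists>T. host_tree T \<H>)"

definition nontrivial_proper_subgroups :: "('a, 'b) monoid_scheme \<Rightarrow> 'a set set" where
  "nontrivial_proper_subgroups G = {H. subgroup H G \<and> H \<noteq> {\<one>\<^bsub>G\<^esub>} \<and> H \<noteq> carrier G}"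

definition intersection_vertices :: "('a, 'b) monoid_scheme \<Rightarrow> 'a set set" where
  "intersection_vertices G =
     {H \<in> nontrivial_proper_subgroups G.
        \<exists>K \<in> nontrivial_proper_subgroups G. H \<inter> K = {\<one>\<^bsub>G\<^esub>}}"

definition trivially_intersecting :: "('a, 'b) monoid_scheme \<Rightarrow> 'a set set \<Rightarrow> bool" where
  "trivially_intersecting G E \<longleftrightarrow> pairwise (\<lambda>H K. H \<inter> K = {\<one>\<^bsub>G\<^esub>}) E"

definition intersection_hypergraph :: "('a, 'b) monoid_scheme \<Rightarrow> 'a set hypergraph" where
  "intersection_hypergraph G =
     (intersection_vertices G,
      {E. E \<subseteq> intersection_vertices G \<and> trivially_intersecting G E \<and>
          \<not> (\<exists>E'. E' \<subseteq> intersection_vertices G \<and> E \<subset> E' \<and> trivially_intersecting G E')})"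

end

theory Submission
  imports Defs "HOL-Algebra.Multiplicative_Group"
begin

text \<open>
  Subgroups of the cyclic group of order \<open>n\<close> correspond to divisors of \<open>n\<close>, with intersection
  becoming gcd. So the vertices are the divisors coprime to some nontrivial divisor, and the
  hyperedges are the maximal sets of pairwise coprime ones.

  A hyperedge \<open>{u, v}\<close> must be an edge of every host tree, and removing it separates \<open>u\<close> from \<open>v\<close>.
  Any other hyperedge not containing both \<open>u\<close> and \<open>v\<close> then lies on one side. Hence a chain of such
  hyperedges leading from \<open>u\<close> to \<open>v\<close> excludes a host tree. With \<open>a, b, c, d\<close> pairwise coprime factors of
  \<open>n\<close> and \<open>a', b'\<close> proper divisors of \<open>a, b\<close> with the same primes, the chains are
  \<open>{a', b}, {a, b}, {a, b'}\<close> for \<open>{a', b'}\<close> if \<open>n = a b\<close>;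
  \<open>{a', b, c}, {a, b, c}, {a, b c}\<close> for \<open>{a', b c}\<close> if \<open>n = a b c\<close>; and
  \<open>{a b, c, d}, {a, b, c, d}, {a, b, c d}\<close> for \<open>{a b, c d}\<close> if \<open>n = a b c d\<close>.

  For \<open>n = p\<^sup>k q\<close> the star centred at \<open>q\<close> is a host tree. For \<open>n = p q r\<close> one takes the tree
  rooted at \<open>q\<close> in which \<open>p, r, p r\<close> are children of \<open>q\<close>, \<open>q r\<close> is a child of \<open>p\<close> and \<open>p q\<close> is a child of \<open>r\<close>.
\<close>

section \<open>Host trees\<close>

text \<open>Connectedness of a digraph refers to its symmetric closure. The arcs of \<open>T\<close>
  are already symmetric, so the closure adds none, and connectedness becomes reachability along arcs
  inside \<open>D\<close>.\<close>

lemma connected_within: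
  assumes "sym (parcs T)" "Digraph_Component.connected (induce_subgraph (with_proj T) D)"
    and "x \<in> D" "y \<in> D"
  shows "(x, y) \<in> (parcs T \<inter> D \<times> D)\<^sup>*"
proof -
  let ?M = "with_proj (mk_symmetric (induce_subgraph (with_proj T) D))"
  have "x \<rightarrow>\<^sup>*\<^bsub>?M\<^esub> y"
    using assms(2-) by (simp add: Digraph_Component.connected_def strongly_connected_def mk_symmetric_def)
  then have "(x, y) \<in> (arcs_ends ?M)\<^sup>*"
    by (rule reachable_rtranclI)
  moreover have "arcs_ends ?M \<subseteq> parcs T \<inter> D \<times> D"
    using assms(1) by (auto simp: mk_symmetric_def dest: symD)
  ultimately show ?thesis
    using rtrancl_mono by blast
qed

text \<open>A walk from \<open>u\<close> to \<open>v\<close> that avoids the edge can be shortened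
  to a path; closing this path with the arc \<open>(v, u)\<close> gives a forbidden cycle.\<close>

lemma undirected_tree_bridge:
  assumes tree: "undirected_tree (with_proj T)" and arc: "(u, v) \<in> parcs T"
  shows "(u, v) \<notin> (parcs T - {(u, v), (v, u)})\<^sup>*"
proof
  assume walk: "(u, v) \<in> (parcs T - {(u, v), (v, u)})\<^sup>*"
  interpret T: loopfree_digraph "with_proj T"
    using tree by (simp add: undirected_tree_def)
  have sym: "sym (parcs T)"
    using tree by (simp add: undirected_tree_def sym_digraph_def sym_digraph_axioms_def symmetric_def)
  have "u \<noteq> v"
    using arc T.no_loops[of "(u, v)"] by simp
  define H where "H = with_proj \<lparr>pverts = pverts T, parcs = parcs T - {(u, v), (v, u)}\<rparr>"
  interpret H: wf_digraph H
    using T.tail_in_verts T.head_in_verts by unfold_locales (auto simp: H_def)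
  have "u \<rightarrow>\<^sup>*\<^bsub>H\<^esub> v"
    using walk arc T.tail_in_verts[of "(u, v)"] by (subst H.reachable_conv') (auto simp: H_def)
  then obtain p where p: "H.apath u p v"
    using H.apath_awalk_to_apath H.reachable_awalk by blast
  have pT: "u \<in> pverts T" "set p \<subseteq> parcs T - {(u, v), (v, u)}" "pcas u p v"
    and dist: "distinct (pawalk_verts u p)"
    using p by (auto simp: pre_digraph.apath_def pre_digraph.awalk_def H_def cas_with_proj_eq awalk_verts_with_proj_eq)
  \<comment> \<open>An empty path would give \<open>u = v\<close>, and a single arc would be the
    deleted arc \<open>(u, v)\<close>. Hence the closed walk has at least three arcs.\<close>
  have "2 \<le> length p"
  proof (rule ccontr)
    assume "\<not> 2 \<le> length p"
    then consider "p = []" | e where "p = [e]"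
      by (cases p rule: list.exhaust; cases "tl p") auto
    then show False
      using pT \<open>u \<noteq> v\<close> by cases (auto simp: prod_eq_iff)
  qed
  \<comment> \<open>The closing arc adds one more \<open>u\<close> at the end of the vertex list.
    Dropping the initial \<open>u\<close> leaves the vertices of the path in another order, so they
    are still distinct.\<close>
  have app: "pcas a (q @ [(v, u)]) u \<and> pawalk_verts a (q @ [(v, u)]) = pawalk_verts a q @ [u]"
    if "pcas a q v" for a q
    using that by (induction q arbitrary: a) auto
  have "hd (pawalk_verts u p) = u" "pawalk_verts u p \<noteq> []"
    using pT(3) by (cases p; simp)+
  then obtain ws where ws: "pawalk_verts u p = u # ws"
    by (metis list.collapse)
  have "T.cycle (p @ [(v, u)])"
    unfolding T.cycle_def T.awalk_def
    using app[OF pT(3)] pT dist ws arc symD[OF sym arc]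
    by (intro exI[of _ u]) (auto simp: cas_with_proj_eq awalk_verts_with_proj_eq)
  then show False
    using tree \<open>2 \<le> length p\<close> unfolding undirected_tree_def
    by (metis Suc_le_mono eval_nat_numeral(3) length_append_singleton numeral_2_eq_2)
qed

text \<open>Since \<open>{u, v}\<close> induces a connected subgraph, \<open>u\<close> and
  \<open>v\<close> are adjacent, so their edge is a bridge. A hyperedge missing one of them is
  connected without this edge and stays in one component of \<open>R\<close>.\<close>

lemma two_element_edge_bridge:
  assumes host: "host_tree T \<H>" and uv: "{u, v} \<in> snd \<H>" "u \<noteq> v"
  defines "R \<equiv> parcs T - {(u, v), (v, u)}"
  shows "(u, v) \<notin> R\<^sup>*"
    and "\<And>D x y. D \<in> snd \<H> \<Longrightarrow> \<not> {u, v} \<subseteq> D \<Longrightarrow> x \<in> D \<Longrightarrow> y \<in> D \<Longrightarrow> (x, y) \<in> R\<^sup>*"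
proof -
  have tree: "undirected_tree (with_proj T)"
    and edges: "\<And>D. D \<in> snd \<H> \<Longrightarrow> Digraph_Component.connected (induce_subgraph (with_proj T) D)"
    using host by (auto simp: host_tree_def undirected_tree_def)
  interpret T: loopfree_digraph "with_proj T"
    using tree by (simp add: undirected_tree_def)
  have sym: "sym (parcs T)"
    using tree by (simp add: undirected_tree_def sym_digraph_def sym_digraph_axioms_def symmetric_def)
  note within = connected_within[OF sym edges]
  have "(u, v) \<in> (parcs T \<inter> {u, v} \<times> {u, v})\<^sup>*"
    using within[OF uv(1)] by simp
  \<comment> \<open>The first arc of the walk inside \<open>{u, v}\<close> is not a loop, so
    \<open>w\<close> is \<open>v\<close>.\<close>
  then obtain w where "(u, w) \<in> parcs T" "w \<in> {u, v}"
    using \<open>u \<noteq> v\<close> by (auto elim: converse_rtranclE)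
  then have "(u, v) \<in> parcs T"
    using T.no_loops[of "(u, u)"] by auto
  then show "(u, v) \<notin> R\<^sup>*"
    unfolding R_def by (rule undirected_tree_bridge[OF tree])
  fix D x y
  assume D: "D \<in> snd \<H>" "\<not> {u, v} \<subseteq> D" "x \<in> D" "y \<in> D"
  then have "parcs T \<inter> D \<times> D \<subseteq> R"
    unfolding R_def by auto
  then show "(x, y) \<in> R\<^sup>*"
    using within[OF D(1) D(3,4)] rtrancl_mono by blast
qed

section \<open>Trees given by a parent map\<close>

lemma pcas_nth:
  assumes "pcas u p v" "p \<noteq> []"
  shows "fst (p ! 0) = u \<and> snd (last p) = v \<and> (\<forall>i. Suc i < length p \<longrightarrow> snd (p ! i) = fst (p ! Suc i))"
  using assms
proof (induction p arbitrary: u)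
  case (Cons e p)
  show ?case
  proof (cases p)
    case (Cons e' p')
    then have "fst (p ! 0) = snd e \<and> snd (last p) = v \<and>
      (\<forall>i. Suc i < length p \<longrightarrow> snd (p ! i) = fst (p ! Suc i))"
      using Cons.IH[of "snd e"] Cons.prems by simp
    then show ?thesis
      using Cons.prems Cons by (auto simp: nth_Cons split: nat.split)
  qed (use Cons in auto)
qed simp

text \<open>Indices modulo the length give every arc of a closed walk both a successor and a
  predecessor, wherever the walk starts. This allows the two neighbours of a deepest vertex on a
  cycle to be named.\<close>

lemma pcas_closed_nth:
  assumes "pcas u p u" "i < length p"
  shows "snd (p ! i) = fst (p ! (Suc i mod length p))"
proof -
  have "p \<noteq> []" using assms by auto
  note * = pcas_nth[OF assms(1) this]
  show ?thesis
  proof (cases "Suc i = length p")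
    case True
    then have "p ! i = last p"
      using \<open>p \<noteq> []\<close> by (simp add: last_conv_nth flip: True)
    then show ?thesis using * True by simp
  qed (use * assms(2) in auto)
qed

text \<open>
  On a cycle of length at least three, a vertex of maximal depth would have two distinct neighbours,
  both equal to its parent.
\<close>

lemma parent_relation_acyclic:
  fixes T :: "'v pair_pre_digraph" and depth :: "'v \<Rightarrow> nat"
  assumes parent: "\<And>x y. (x, y) \<in> parcs T \<Longrightarrow>
      depth x < depth y \<and> par y = x \<or> depth y < depth x \<and> par x = y"
    and cyc: "pre_digraph.cycle (with_proj T) p"
  shows "length p < 3"
proof (rule ccontr)
  assume "\<not> length p < 3"
  then have m: "3 \<le> length p" by simp
  obtain u where p: "set p \<subseteq> parcs T" "pcas u p u" "distinct (tl (pawalk_verts u p))" "p \<noteq> []"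
    using cyc by (auto simp: pre_digraph.cycle_def pre_digraph.awalk_def cas_with_proj_eq
        awalk_verts_with_proj_eq)
  \<comment> \<open>After its start, a walk visits the heads of its arcs, so on a cycle the heads
    are distinct.\<close>
  have "pcas a q b \<Longrightarrow> tl (pawalk_verts a q) = map snd q" for a b q
  proof (induction q arbitrary: a)
    case (Cons e q)
    then show ?case by (cases q) auto
  qed simp
  then have dist: "distinct (map snd p)"
    using p by metis
  obtain e where e: "e \<in> set p" "\<And>f. f \<in> set p \<Longrightarrow> depth (snd f) \<le> depth (snd e)"
    using Max_in[of "(depth \<circ> snd) ` set p"] Max_ge[of "(depth \<circ> snd) ` set p"] \<open>p \<noteq> []\<close> by fastforce
  then obtain i where i: "i < length p" "p ! i = e"
    by (auto simp: in_set_conv_nth)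
  \<comment> \<open>Arc \<open>k\<close> follows and arc \<open>j\<close> precedes \<open>e\<close>
    cyclically; they differ because the length is at least three. The head of arc \<open>j\<close>
    and the head of arc \<open>k\<close> are both the parent of the deepest vertex
    \<open>snd e\<close>, contradicting distinct heads.\<close>
  define k where "k = Suc i mod length p"
  define j where "j = (if i = 0 then length p - 1 else i - 1)"
  have jk: "j < length p" "k < length p" "Suc j mod length p = i" "j \<noteq> k"
    using m i by (auto simp: j_def k_def mod_Suc)
  have "snd (p ! j) = fst e" "fst (p ! k) = snd e"
    using pcas_closed_nth[OF p(2) jk(1)] pcas_closed_nth[OF p(2) i(1)] jk i by (simp_all add: k_def)
  moreover have "p ! j \<in> set p" "p ! k \<in> set p"
    using jk by auto
  ultimately have "depth (fst e) \<le> depth (snd e)" "depth (snd (p ! k)) \<le> depth (fst (p ! k))"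
    using e(2) by metis+
  then have "fst e = par (snd e)" "snd (p ! k) = par (fst (p ! k))"
    using parent[of "fst e" "snd e"] parent[of "fst (p ! k)" "snd (p ! k)"] e(1) p(1) \<open>p ! k \<in> set p\<close>
    by auto
  then have "snd (p ! j) = snd (p ! k)"
    using \<open>snd (p ! j) = fst e\<close> \<open>fst (p ! k) = snd e\<close> by simp
  then show False
    using nth_eq_iff_index_eq[OF dist, of j k] jk by simp
qed

text \<open>Arcs join vertices to their parents only, which excludes cycles. Any two vertices of
  \<open>D\<close> are joined through \<open>c\<close>, going back from \<open>c\<close> by
  symmetry. The set \<open>D\<close> may be a hyperedge or the whole vertex set, so both demands on
  a host tree are covered.\<close>

lemma undirected_treeI_parent:
  fixes T :: "'v pair_pre_digraph" and depth :: "'v \<Rightarrow> nat"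
  assumes wf: "parcs T \<subseteq> pverts T \<times> pverts T" and sym: "sym (parcs T)"
    and parent: "\<And>x y. (x, y) \<in> parcs T \<Longrightarrow>
      depth x < depth y \<and> par y = x \<or> depth y < depth x \<and> par x = y"
    and D: "D \<subseteq> pverts T" and c: "c \<in> D" "\<And>x. x \<in> D \<Longrightarrow> (x, c) \<in> (parcs T \<inter> D \<times> D)\<^sup>*"
  shows "undirected_tree (induce_subgraph (with_proj T) D)"
proof -
  define S where "S = \<lparr>pverts = D, parcs = parcs T \<inter> D \<times> D\<rparr>"
  have S: "induce_subgraph (with_proj T) D = with_proj S"
    by (auto simp: induce_subgraph_def with_proj_def S_def)
  have symS: "sym (parcs S)"
    using sym by (auto simp: S_def sym_def)
  interpret S: wf_digraph "with_proj S"
    by unfold_locales (auto simp: S_def)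
  have "x \<rightarrow>\<^sup>*\<^bsub>with_proj S\<^esub> y" if "x \<in> D" "y \<in> D" for x y
  proof -
    have "(x, c) \<in> (parcs S)\<^sup>*" "(y, c) \<in> (parcs S)\<^sup>*"
      using c(2) that by (auto simp: S_def)
    moreover have "sym ((parcs S)\<^sup>*)"
      using symS by (rule sym_rtrancl)
    ultimately have "(x, y) \<in> (parcs S)\<^sup>*"
      by (meson rtrancl_trans symD)
    then show ?thesis
      using that by (subst S.reachable_conv') (auto simp: S_def)
  qed
  moreover have "(\<Union>e\<in>parcs S. {(fst e, snd e), (snd e, fst e)}) = parcs S"
    by (auto intro: symD[OF symS])
  then have "mk_symmetric (with_proj S) = S"
    by (simp add: mk_symmetric_def S_def)
  ultimately have conn: "Digraph_Component.connected (with_proj S)"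
    using c(1) by (auto simp: Digraph_Component.connected_def strongly_connected_def S_def)
  have "length p < 3" if "pre_digraph.cycle (with_proj S) p" for p
    using parent by (intro parent_relation_acyclic[OF _ that, of depth par]) (simp add: S_def)
  then have "\<not> (\<exists>p. pre_digraph.cycle (with_proj S) p \<and> 3 \<le> length p)"
    by (meson not_less)
  moreover have "loopfree_digraph (with_proj S)"
    using parent by unfold_locales (force simp: S_def)
  moreover have "nomulti_digraph (with_proj S)"
    by unfold_locales (auto simp: arc_to_ends_def)
  moreover have "sym_digraph (with_proj S)"
    using symS by unfold_locales (simp add: symmetric_def)
  ultimately show ?thesis
    unfolding S undirected_tree_def using conn by blast
qed

text \<open>Decreasing depth leads every index to the root \<open>r\<close>, so the whole graph is
  connected. Every hyperedge is a star, a centre \<open>c\<close> with some of its children, and so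
  is connected too. Vertices are named through \<open>f\<close> so that the tree can be described on
  divisors instead of subgroups.\<close>

lemma hypertreeI_parent:
  fixes f :: "'a \<Rightarrow> 'v" and depth :: "'a \<Rightarrow> nat"
  assumes inj: "inj_on f I" and r: "r \<in> I"
    and par: "\<And>i. i \<in> I \<Longrightarrow> i \<noteq> r \<Longrightarrow> par i \<in> I \<and> depth (par i) < depth i"
    and star: "\<And>D. D \<in> E \<Longrightarrow> \<exists>A c. D = f ` A \<and> A \<subseteq> I \<and> c \<in> A \<and> (\<forall>a \<in> A - {c}. a \<noteq> r \<and> par a = c)"
  shows "hypertree (f ` I, E)"
proof -
  define up where "up = (\<lambda>i. (f i, f (par i))) ` (I - {r})"
  define T where "T = \<lparr>pverts = f ` I, parcs = up \<union> up\<inverse>\<rparr>"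
  \<comment> \<open>\<open>g\<close> recovers the index of a vertex and so carries
    \<open>depth\<close> and \<open>par\<close> over to vertices.\<close>
  define g where "g = the_inv_into I f"
  have g: "g (f i) = i" if "i \<in> I" for i
    using inj that by (simp add: g_def the_inv_into_f_f)
  have wf: "parcs T \<subseteq> pverts T \<times> pverts T" and sym: "sym (parcs T)"
    using par by (auto simp: T_def up_def sym_Un_converse)
  have parent: "(depth \<circ> g) x < (depth \<circ> g) y \<and> (f \<circ> par \<circ> g) y = x \<or>
      (depth \<circ> g) y < (depth \<circ> g) x \<and> (f \<circ> par \<circ> g) x = y" if "(x, y) \<in> parcs T" for x y
    using that par by (auto simp: T_def up_def g)
  note treeI = undirected_treeI_parent[OF wf sym parent]
  have "(f i, f r) \<in> (parcs T \<inter> f ` I \<times> f ` I)\<^sup>*" if "i \<in> I" for i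
    using that
  proof (induction "depth i" arbitrary: i rule: less_induct)
    case less
    show ?case
    proof (cases "i = r")
      case False
      then have "(f i, f (par i)) \<in> parcs T \<inter> f ` I \<times> f ` I"
        using less.prems par by (auto simp: T_def up_def)
      moreover have "(f (par i), f r) \<in> (parcs T \<inter> f ` I \<times> f ` I)\<^sup>*"
        using less par False by simp
      ultimately show ?thesis
        by (rule converse_rtrancl_into_rtrancl)
    qed simp
  qed
  then have "undirected_tree (induce_subgraph (with_proj T) (f ` I))"
    using r by (intro treeI[of _ "f r"]) (auto simp: T_def)
  moreover have "induce_subgraph (with_proj T) (f ` I) = with_proj T"
    using wf by (auto simp: induce_subgraph_def with_proj_def T_def)
  moreover have "undirected_tree (induce_subgraph (with_proj T) D) \<and> D \<subseteq> f ` I" if D: "D \<in> E" for D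
  proof -
    obtain A c where A: "D = f ` A" "A \<subseteq> I" "c \<in> A" "\<And>a. a \<in> A - {c} \<Longrightarrow> a \<noteq> r \<and> par a = c"
      using star[OF D] by metis
    have "(f a, f c) \<in> (parcs T \<inter> D \<times> D)\<^sup>*" if "a \<in> A" for a
    proof (cases "a = c")
      case False
      then have a: "a \<in> I - {r}" "par a = c"
        using A that by auto
      then have "(f a, f (par a)) \<in> up"
        unfolding up_def by blast
      then have "(f a, f c) \<in> parcs T \<inter> D \<times> D"
        using A that a by (auto simp: T_def)
      then show ?thesis ..
    qed simp
    then show ?thesis
      using A by (intro conjI treeI[of _ "f c"]) (auto simp: T_def)
  qed
  ultimately have "host_tree T (f ` I, E)" "wf_hypergraph (f ` I, E)"
    by (auto simp: host_tree_def wf_hypergraph_def T_def)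
  then show ?thesis
    by (auto simp: hypertree_def)
qed

section \<open>Subgroups of finite cyclic groups\<close>

text \<open>For \<open>d\<close> dividing \<open>n\<close>, this is the subgroup of order \<open>d\<close>.\<close>

definition zsub :: "nat \<Rightarrow> nat \<Rightarrow> int set" where
  "zsub n d = {x \<in> {0..<int n}. int n dvd int d * x}"

text \<open>With \<open>n = d * m\<close>, membership means divisibility by \<open>m\<close>, so the
  elements are the \<open>d\<close> multiples of \<open>m\<close> below \<open>n\<close>.\<close>

lemma card_zsub:
  assumes "n > 0" "d dvd n"
  shows "card (zsub n d) = d"
proof -
  obtain m where m: "n = d * m"
      using assms(2) by (rule dvdE)
  then have "d > 0" "m > 0" using assms by auto
  have "zsub n d = (\<lambda>i. int i * int m) ` {0..<d}"
  proof (intro equalityI subsetI)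
    fix x assume "x \<in> zsub n d"
    then have x: "0 \<le> x" "x < int d * int m" "int m dvd x"
      using \<open>d > 0\<close> by (auto simp: zsub_def m)
    then obtain k where k: "x = k * int m"
      by (metis dvdE mult.commute)
    then have "0 \<le> k" "k < int d"
      using x \<open>m > 0\<close> by (simp_all add: zero_le_mult_iff)
    then have "x = int (nat k) * int m" "nat k < d"
      using k by auto
    then show "x \<in> (\<lambda>i. int i * int m) ` {0..<d}"
      by (intro image_eqI[of _ _ "nat k"]) simp_all
  qed (use \<open>m > 0\<close> in \<open>auto simp: zsub_def m\<close>)
  moreover have "inj_on (\<lambda>i. int i * int m) {0..<d}"
    using \<open>m > 0\<close> by (auto simp: inj_on_def)
  ultimately show ?thesis
    by (simp add: card_image)
qed

lemma inj_on_zsub: "n > 0 \<Longrightarrow> inj_on (zsub n) {d. d dvd n}"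
  by (rule inj_on_inverseI[of _ card]) (simp add: card_zsub)

text \<open>A number divides both \<open>d * x\<close> and \<open>e * x\<close> iff it divides their
  gcd, which is \<open>gcd d e\<close> times the absolute value of \<open>x\<close>.\<close>

lemma zsub_Int: "zsub n d \<inter> zsub n e = zsub n (gcd d e)"
proof -
  have "int n dvd int (gcd d e) * x \<longleftrightarrow> int n dvd int d * x \<and> int n dvd int e * x" for x
  proof -
    have "int n dvd int (gcd d e) * x \<longleftrightarrow> int n dvd \<bar>int (gcd d e) * x\<bar>"
      by simp
    also have "\<bar>int (gcd d e) * x\<bar> = gcd (int d * x) (int e * x)"
      by (simp add: abs_mult gcd_mult_right gcd.commute flip: gcd_int_int_eq)
    finally show ?thesis by simp
  qed
  then show ?thesis
    by (auto simp: zsub_def)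
qed

lemma zsub_1: "n > 0 \<Longrightarrow> zsub n 1 = {0}"
  using zdvd_not_zless[of _ "int n"] by (auto simp: zsub_def order_le_less)

lemma zsub_self: "zsub n n = {0..<int n}"
  by (auto simp: zsub_def)

text \<open>By Lagrange the order of \<open>H\<close> divides \<open>n\<close> and annihilates every
  element of \<open>H\<close>. So \<open>H\<close> lies in \<open>zsub n (card H)\<close>, which has
  just as many elements.\<close>

lemma subgroup_integer_mod_group_iff:
  assumes "n > 0"
  shows "subgroup H (integer_mod_group n) \<longleftrightarrow> (\<exists>d. d dvd n \<and> H = zsub n d)"
proof
  interpret group "integer_mod_group n" by simp
  have carrier: "carrier (integer_mod_group n) = {0..<int n}"
    using assms by (simp add: carrier_integer_mod_group)
  assume H: "subgroup H (integer_mod_group n)"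
  interpret H: group "integer_mod_group n\<lparr>carrier := H\<rparr>"
    by (rule subgroup.subgroup_is_group[OF H is_group])
  have HC: "H \<subseteq> {0..<int n}"
    using subgroup.subset[OF H] carrier by simp
  then have fin: "finite H"
    by (rule finite_subset) simp
  have dvd: "card H dvd n"
    using lagrange[OF H] unfolding order_def carrier card_atLeastZeroLessThan_int nat_int
    by (metis dvd_triv_right)
  have "int n dvd int (card H) * x" if "x \<in> H" for x
  proof -
    have "x [^]\<^bsub>integer_mod_group n\<lparr>carrier := H\<rparr>\<^esub> card H = 0"
      using H.pow_order_eq_1[of x] that by (simp add: order_def)
    then have "(int (card H) * x) mod int n = 0"
      using nat_pow_consistent[of x "card H" H] by simp
    then show ?thesis by auto
  qed
  then have "H \<subseteq> zsub n (card H)"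
    using HC by (auto simp: zsub_def)
  moreover have "card (zsub n (card H)) = card H"
    using card_zsub[OF assms dvd] .
  moreover have "finite (zsub n (card H))"
    by (rule finite_subset[of _ "{0..<int n}"]) (auto simp: zsub_def)
  ultimately have "H = zsub n (card H)"
    by (simp add: card_subset_eq)
  then show "\<exists>d. d dvd n \<and> H = zsub n d"
    using dvd by blast
next
  interpret group "integer_mod_group n" by simp
  have carrier: "carrier (integer_mod_group n) = {0..<int n}"
    using assms by (simp add: carrier_integer_mod_group)
  assume "\<exists>d. d dvd n \<and> H = zsub n d"
  then obtain d where d: "H = zsub n d" by blast
  \<comment> \<open>The defining divisibility is unchanged by reduction modulo \<open>n\<close>, so
    closure can be checked on integers before reducing.\<close>
  have "int n dvd int d * (z mod int n) \<longleftrightarrow> int n dvd int d * z" for z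
    by (metis dvd_eq_mod_eq_0 mod_mult_right_eq)
  then have mod: "int n dvd int d * (z mod int n)" if "int n dvd int d * z" for z
    using that by simp
  have mem: "z mod int n \<in> H" if "int n dvd int d * z" for z
    using assms mod[OF that] unfolding d zsub_def by simp
  show "subgroup H (integer_mod_group n)"
  proof (rule subgroupI)
    show "H \<subseteq> carrier (integer_mod_group n)"
      unfolding carrier d zsub_def by blast
    show "H \<noteq> {}"
      using mem[of 0] by auto
  next
    fix a assume a: "a \<in> H"
    then have "a \<in> carrier (integer_mod_group n)" "int n dvd int d * - a"
      unfolding carrier d zsub_def by simp_all
    then show "inv\<^bsub>integer_mod_group n\<^esub> a \<in> H"
      using mem by simp
  next
    fix a b assume "a \<in> H" "b \<in> H"
    then have "int n dvd int d * (a + b)"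
      unfolding d zsub_def by (simp add: distrib_left)
    then show "a \<otimes>\<^bsub>integer_mod_group n\<^esub> b \<in> H"
      using mem by simp
  qed
qed

section \<open>Vertices and hyperedges in terms of divisors\<close>

text \<open>These are the orders of the subgroups that are vertices. Properness is built in: a
  divisor coprime to a divisor \<open>e\<close> of \<open>n\<close> other than 1 cannot be
  \<open>n\<close> itself.\<close>

definition coprime_divisors :: "nat \<Rightarrow> nat set" where
  "coprime_divisors n = {d. d dvd n \<and> d \<noteq> 1 \<and> (\<exists>e. e dvd n \<and> e \<noteq> 1 \<and> coprime d e)}"

lemma zsub_disjoint_iff:
  assumes "n > 0" "d dvd n" "e dvd n"
  shows "zsub n d \<inter> zsub n e = {0} \<longleftrightarrow> coprime d e"
proof -
  have "zsub n d \<inter> zsub n e = {0} \<longleftrightarrow> zsub n (gcd d e) = zsub n 1"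
    using assms zsub_1[of n] by (simp add: zsub_Int)
  also have "\<dots> \<longleftrightarrow> gcd d e = 1"
    using assms dvd_trans[OF gcd_dvd1 assms(2)] by (intro inj_on_eq_iff[OF inj_on_zsub]) simp_all
  finally show ?thesis
    by (simp add: coprime_iff_gcd_eq_1)
qed

lemma intersection_vertices_integer_mod_group:
  assumes "n > 0"
  shows "intersection_vertices (integer_mod_group n) = zsub n ` coprime_divisors n"
proof -
  have car: "carrier (integer_mod_group n) = zsub n n"
    using assms by (simp add: carrier_integer_mod_group zsub_self)
  have eq: "zsub n d = zsub n e \<longleftrightarrow> d = e" if "d dvd n" "e dvd n" for d e
    using inj_on_eq_iff[OF inj_on_zsub[OF assms]] that by simp
  have proper: "zsub n d \<noteq> {0} \<and> zsub n d \<noteq> zsub n n \<longleftrightarrow> d \<noteq> 1 \<and> d \<noteq> n" if "d dvd n" for d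
    using eq[OF that, of 1] eq[OF that, of n] zsub_1[OF assms] by simp
  have S: "H \<in> nontrivial_proper_subgroups (integer_mod_group n) \<longleftrightarrow>
      (\<exists>d. d dvd n \<and> d \<noteq> 1 \<and> d \<noteq> n \<and> H = zsub n d)" for H
    unfolding nontrivial_proper_subgroups_def subgroup_integer_mod_group_iff[OF assms] car
      one_integer_mod_group mem_Collect_eq
    using proper by metis
  have ne: "d \<noteq> n \<and> e \<noteq> n" if "d dvd n" "d \<noteq> 1" "e dvd n" "e \<noteq> 1" "coprime d e" for d e
    using that by auto
  show ?thesis
  proof (intro equalityI subsetI)
    fix H assume "H \<in> intersection_vertices (integer_mod_group n)"
    then obtain d e where "d dvd n" "d \<noteq> 1" "H = zsub n d" "e dvd n" "e \<noteq> 1" "zsub n d \<inter> zsub n e = {0}"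
      unfolding intersection_vertices_def mem_Collect_eq Bex_def S one_integer_mod_group by metis
    then show "H \<in> zsub n ` coprime_divisors n"
      using zsub_disjoint_iff[OF assms] unfolding coprime_divisors_def by blast
  next
    fix H assume "H \<in> zsub n ` coprime_divisors n"
    then obtain d e where de: "d dvd n" "d \<noteq> 1" "e dvd n" "e \<noteq> 1" "coprime d e" and H: "H = zsub n d"
      unfolding coprime_divisors_def by blast
    then have "H \<in> nontrivial_proper_subgroups (integer_mod_group n)"
      "zsub n e \<in> nontrivial_proper_subgroups (integer_mod_group n)" "H \<inter> zsub n e = {0}"
      using ne[OF de] zsub_disjoint_iff[OF assms, of d e] unfolding S by blast+
    then show "H \<in> intersection_vertices (integer_mod_group n)"
      unfolding intersection_vertices_def by auto
  qed
qed

lemma trivially_intersecting_zsub_iff: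
  assumes "n > 0" and A: "A \<subseteq> coprime_divisors n"
  shows "trivially_intersecting (integer_mod_group n) (zsub n ` A) \<longleftrightarrow> pairwise coprime A"
proof -
  have "zsub n d \<inter> zsub n e = {0} \<longleftrightarrow> coprime d e" "zsub n d = zsub n e \<longleftrightarrow> d = e"
    if "d \<in> A" "e \<in> A" for d e
  proof -
    have "d dvd n" "e dvd n"
      using that A by (auto simp: coprime_divisors_def)
    then show "zsub n d \<inter> zsub n e = {0} \<longleftrightarrow> coprime d e" "zsub n d = zsub n e \<longleftrightarrow> d = e"
      using zsub_disjoint_iff[OF assms(1)] inj_on_eq_iff[OF inj_on_zsub[OF assms(1)]] by simp_all
  qed
  then show ?thesis
    unfolding trivially_intersecting_def pairwise_def one_integer_mod_group by simp
qed

text \<open>Subsets of pairwise coprime sets are pairwise coprime, so a set that can be enlarged at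
  all can be enlarged by one element. Maximality thus becomes a condition on single
  divisors.\<close>

lemma hyperedge_integer_mod_group_iff:
  assumes "n > 0"
  shows "D \<in> snd (intersection_hypergraph (integer_mod_group n)) \<longleftrightarrow>
    (\<exists>A \<subseteq> coprime_divisors n. D = zsub n ` A \<and> pairwise coprime A \<and>
      (\<forall>d \<in> coprime_divisors n. (\<forall>a \<in> A. coprime a d) \<longrightarrow> d \<in> A))"
proof -
  let ?C = "coprime_divisors n" and ?ti = "trivially_intersecting (integer_mod_group n)"
  have "?C \<subseteq> {d. d dvd n}"
    by (auto simp: coprime_divisors_def)
  then have inj: "inj_on (zsub n) ?C"
    by (rule inj_on_subset[OF inj_on_zsub[OF assms]])
  note triv = trivially_intersecting_zsub_iff[OF assms]
  have hyp: "D \<in> snd (intersection_hypergraph (integer_mod_group n)) \<longleftrightarrow>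
      D \<subseteq> zsub n ` ?C \<and> ?ti D \<and> \<not> (\<exists>E'. E' \<subseteq> zsub n ` ?C \<and> D \<subset> E' \<and> ?ti E')"
    unfolding intersection_hypergraph_def intersection_vertices_integer_mod_group[OF assms] by simp
  show ?thesis
  proof
    assume "D \<in> snd (intersection_hypergraph (integer_mod_group n))"
    then have D: "D \<subseteq> zsub n ` ?C" "?ti D" "\<And>E'. E' \<subseteq> zsub n ` ?C \<Longrightarrow> D \<subset> E' \<Longrightarrow> \<not> ?ti E'"
      unfolding hyp by simp_all
    obtain A where A: "A \<subseteq> ?C" "D = zsub n ` A"
      using D(1) by (rule subset_imageE)
    have "pairwise coprime A"
      using D(2) triv[OF A(1)] A(2) by simp
    moreover have "d \<in> A" if d: "d \<in> ?C" "\<forall>a \<in> A. coprime a d" for d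
    proof (rule ccontr)
      assume "d \<notin> A"
      have C: "insert d A \<subseteq> ?C"
        using d(1) A(1) by simp
      have "zsub n d \<notin> D"
        using inj_on_image_mem_iff[OF inj d(1) A(1)] A(2) \<open>d \<notin> A\<close> by simp
      then have "D \<subset> zsub n ` insert d A"
        using A(2) by auto
      then have "\<not> ?ti (zsub n ` insert d A)"
        using D(3) C by (simp add: image_mono del: image_insert)
      then have "\<not> pairwise coprime (insert d A)"
        using triv[OF C] by simp
      then show False
        using \<open>pairwise coprime A\<close> d(2) by (auto simp: pairwise_insert coprime_commute)
    qed
    ultimately show "\<exists>A \<subseteq> ?C. D = zsub n ` A \<and> pairwise coprime A \<and>
        (\<forall>d \<in> ?C. (\<forall>a \<in> A. coprime a d) \<longrightarrow> d \<in> A)"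
      using A by blast
  next
    assume "\<exists>A \<subseteq> ?C. D = zsub n ` A \<and> pairwise coprime A \<and>
        (\<forall>d \<in> ?C. (\<forall>a \<in> A. coprime a d) \<longrightarrow> d \<in> A)"
    then obtain A where A: "A \<subseteq> ?C" "D = zsub n ` A" "pairwise coprime A"
      and max: "\<And>d. d \<in> ?C \<Longrightarrow> \<forall>a \<in> A. coprime a d \<Longrightarrow> d \<in> A"
      by blast
    have "\<not> ?ti E'" if E: "E' \<subseteq> zsub n ` ?C" "D \<subset> E'" for E'
    proof
      assume "?ti E'"
      obtain B where B: "B \<subseteq> ?C" "E' = zsub n ` B"
        using E(1) by (rule subset_imageE)
      have "pairwise coprime B"
        using \<open>?ti E'\<close> triv[OF B(1)] B(2) by simp
      have "A \<subseteq> B"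
      proof
        fix a assume "a \<in> A"
        moreover from this have "zsub n a \<in> zsub n ` B"
          using E(2) unfolding A(2) B(2) by blast
        ultimately show "a \<in> B"
          using inj_on_image_mem_iff[OF inj _ B(1)] A(1) by blast
      qed
      moreover obtain b where b: "b \<in> B" "b \<notin> A"
        using E(2) unfolding A(2) B(2) by blast
      ultimately have "\<forall>a \<in> A. coprime a b"
        using \<open>pairwise coprime B\<close> by (metis pairwiseD subsetD)
      then show False
        using max b B(1) by blast
    qed
    then show "D \<in> snd (intersection_hypergraph (integer_mod_group n))"
      unfolding hyp using A triv[OF A(1)] by (simp add: image_mono)
  qed
qed

section \<open>Values excluded by a bridge\<close>

text \<open>An easily checked sufficient condition for a hyperedge. The clause with
  \<open>{a}\<close> says that there are at least two members, so each has a coprime partner and is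
  a vertex.\<close>

definition coprime_cover :: "nat \<Rightarrow> nat set \<Rightarrow> bool" where
  "coprime_cover n A \<longleftrightarrow> (\<forall>a \<in> A. a dvd n \<and> a \<noteq> 1) \<and> pairwise coprime A \<and>
     (\<forall>a. \<not> A \<subseteq> {a}) \<and> (\<forall>p. prime p \<longrightarrow> p dvd n \<longrightarrow> (\<exists>a \<in> A. p dvd a))"

text \<open>A vertex coprime to all members would have a prime factor, which already divides some
  member; so nothing can be added.\<close>

lemma coprime_cover_hyperedge:
  assumes "n > 0" and cover: "coprime_cover n A"
  shows "zsub n ` A \<in> snd (intersection_hypergraph (integer_mod_group n))"
proof -
  have A: "A \<subseteq> coprime_divisors n"
  proof
    fix a assume a: "a \<in> A"
    have "\<not> A \<subseteq> {a}"
      using cover by (simp add: coprime_cover_def)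
    then obtain b where b: "b \<in> A" "a \<noteq> b"
      by blast
    then have "coprime a b"
      using cover a by (simp add: coprime_cover_def pairwise_def)
    then show "a \<in> coprime_divisors n"
      using cover a b unfolding coprime_cover_def coprime_divisors_def mem_Collect_eq by metis
  qed
  have "d \<in> A" if d: "d \<in> coprime_divisors n" "\<forall>a \<in> A. coprime a d" for d
  proof -
    have "d dvd n" "d \<noteq> 1"
      using d(1) unfolding coprime_divisors_def by blast+
    obtain p where p: "prime p" "p dvd d"
      using prime_factor_nat[OF \<open>d \<noteq> 1\<close>] by blast
    have "p dvd n"
      using p(2) \<open>d dvd n\<close> by (rule dvd_trans)
    then obtain a where "a \<in> A" "p dvd a"
      using cover p(1) by (auto simp: coprime_cover_def)
    then show ?thesis
      using p d(2) coprime_common_divisor[of a d p] not_prime_unit[of p] by blast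
  qed
  moreover have "pairwise coprime A"
    using cover unfolding coprime_cover_def by blast
  ultimately show ?thesis
    unfolding hyperedge_integer_mod_group_iff[OF assms(1)] using A by blast
qed

text \<open>Brings the bridge property down to divisors: \<open>R\<close> relates numbers whose
  subgroups stay connected in the host tree once the edge for \<open>u\<close> and \<open>v\<close>
  is deleted. Chains of covers are composed by transitivity of \<open>R\<close>.\<close>

lemma coprime_cover_bridge:
  assumes "n > 0" and tree: "hypertree (intersection_hypergraph (integer_mod_group n))"
    and uv: "coprime_cover n {u, v}"
  obtains R where "trans R" "(u, v) \<notin> R"
    "\<And>A x y. coprime_cover n A \<Longrightarrow> \<not> {u, v} \<subseteq> A \<Longrightarrow> x \<in> A \<Longrightarrow> y \<in> A \<Longrightarrow> (x, y) \<in> R"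
proof -
  let ?G = "intersection_hypergraph (integer_mod_group n)"
  obtain T where T: "host_tree T ?G"
    using tree by (auto simp: hypertree_def)
  have div: "A \<subseteq> {d. d dvd n}" if "coprime_cover n A" for A
    using that by (auto simp: coprime_cover_def)
  have "u \<noteq> v"
    using uv by (auto simp: coprime_cover_def)
  have "{zsub n u, zsub n v} \<in> snd ?G"
    using coprime_cover_hyperedge[OF assms(1) uv] by simp
  moreover have "zsub n u \<noteq> zsub n v"
    using inj_on_eq_iff[OF inj_on_zsub[OF assms(1)]] div[OF uv] \<open>u \<noteq> v\<close> by simp
  ultimately have bridge: "(zsub n u, zsub n v) \<notin> (parcs T - {(zsub n u, zsub n v), (zsub n v, zsub n u)})\<^sup>*"
    "\<And>D x y. D \<in> snd ?G \<Longrightarrow> \<not> {zsub n u, zsub n v} \<subseteq> D \<Longrightarrow> x \<in> D \<Longrightarrow> y \<in> D \<Longrightarrow>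
      (x, y) \<in> (parcs T - {(zsub n u, zsub n v), (zsub n v, zsub n u)})\<^sup>*"
    using two_element_edge_bridge[OF T] by blast+
  define R where "R = inv_image ((parcs T - {(zsub n u, zsub n v), (zsub n v, zsub n u)})\<^sup>*) (zsub n)"
  show ?thesis
  proof
    show "trans R"
      unfolding R_def by (intro trans_inv_image trans_rtrancl)
    show "(u, v) \<notin> R"
      using bridge(1) by (simp add: R_def)
    fix A x y assume A: "coprime_cover n A" "\<not> {u, v} \<subseteq> A" "x \<in> A" "y \<in> A"
    have mem: "z \<in> A" if "z \<in> {u, v}" "zsub n z \<in> zsub n ` A" for z
    proof -
      have "z \<in> {d. d dvd n}"
        using that(1) div[OF uv] by (rule subsetD[rotated])
      then show ?thesis
        using that(2) inj_on_image_mem_iff[OF inj_on_zsub[OF assms(1)] _ div[OF A(1)]] by simp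
    qed
    have "\<not> {zsub n u, zsub n v} \<subseteq> zsub n ` A"
      using mem[of u] mem[of v] A(2) by (metis empty_subsetI insertCI insert_subset)
    then show "(x, y) \<in> R"
      using bridge(2)[OF coprime_cover_hyperedge[OF assms(1) A(1)]] A(3,4) by (simp add: R_def)
  qed
qed

lemma coprime_coverI:
  assumes "\<And>a. a \<in> A \<Longrightarrow> a dvd n \<and> a \<noteq> 1" "pairwise coprime A" "x \<in> A" "y \<in> A" "x \<noteq> y"
    and "\<And>p. prime p \<Longrightarrow> p dvd n \<Longrightarrow> \<exists>a \<in> A. p dvd a"
  shows "coprime_cover n A"
proof -
  have "\<not> A \<subseteq> {a}" for a
    using assms(3-5) by blast
  then show ?thesis
    using assms(1,2,6) by (simp add: coprime_cover_def)
qed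

lemma coprime_cover_neq:
  assumes "coprime_cover n {x, y}"
  shows "x \<noteq> y"
proof
  assume "x = y"
  moreover have "\<not> {x, y} \<subseteq> {x}"
    using assms unfolding coprime_cover_def by blast
  ultimately show False by simp
qed

lemma coprime_neq: "coprime a b \<Longrightarrow> a \<noteq> 1 \<Longrightarrow> a \<noteq> b" for a b :: nat
  by auto

section \<open>Obstructions from two, three and four coprime factors\<close>

text \<open>Replacing a factor by a divisor with the same primes keeps a cover, so all four pairs
  are hyperedges. The three pairs other than \<open>{a', b'}\<close> link \<open>a'\<close>,
  \<open>b\<close>, \<open>a\<close>, \<open>b'\<close> in turn, bypassing the bridge.\<close>

lemma not_hypertree_two_factors:
  fixes a b a' b' :: nat
  assumes "coprime a b" "a' dvd a" "a' \<noteq> a" "a' \<noteq> 1" "b' dvd b" "b' \<noteq> b" "b' \<noteq> 1" "a > 0" "b > 0"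
    and rad: "\<And>p. prime p \<Longrightarrow> p dvd a \<Longrightarrow> p dvd a'" "\<And>p. prime p \<Longrightarrow> p dvd b \<Longrightarrow> p dvd b'"
  shows "\<not> hypertree (intersection_hypergraph (integer_mod_group (a * b)))"
proof
  assume tree: "hypertree (intersection_hypergraph (integer_mod_group (a * b)))"
  have cover: "coprime_cover (a * b) {x, y}" if "x \<in> {a, a'}" "y \<in> {b, b'}" for x y
  proof -
    have dvd: "x dvd a" "x \<noteq> 1" "y dvd b" "y \<noteq> 1"
      using that assms by auto
    then have co: "coprime x y"
      using assms(1) coprime_divisors by blast
    show ?thesis
    proof (rule coprime_coverI[of _ _ x y])
      show "x \<noteq> y" using coprime_neq[OF co dvd(2)] .
      show "pairwise coprime {x, y}"
        using co by (auto simp: pairwise_insert coprime_commute)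
      fix p :: nat assume "prime p" "p dvd a * b"
      then have "p dvd x \<or> p dvd y"
        using that rad by (auto simp: prime_dvd_mult_iff)
      then show "\<exists>c\<in>{x, y}. p dvd c" by simp
    qed (use dvd in auto)
  qed
  have ne: "x \<noteq> y" if "x \<in> {a, a'}" "y \<in> {b, b'}" for x y
    using coprime_cover_neq[OF cover[OF that]] .
  have nes: "a \<noteq> b" "a \<noteq> b'" "a' \<noteq> b" "a' \<noteq> b'"
    using ne[of a b] ne[of a b'] ne[of a' b] ne[of a' b'] by simp_all
  have "coprime_cover (a * b) {a', b'}"
    by (simp add: cover)
  then obtain R where R: "trans R" "(a', b') \<notin> R"
    "\<And>A x y. coprime_cover (a * b) A \<Longrightarrow> \<not> {a', b'} \<subseteq> A \<Longrightarrow> x \<in> A \<Longrightarrow> y \<in> A \<Longrightarrow> (x, y) \<in> R"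
    using coprime_cover_bridge[OF _ tree, of a' b'] assms(8,9) by auto
  have "(a', b) \<in> R"
    by (rule R(3)[of "{a', b}"]) (use cover nes assms in auto)
  moreover have "(b, a) \<in> R"
    by (rule R(3)[of "{a, b}"]) (use cover nes assms in auto)
  moreover have "(a, b') \<in> R"
    by (rule R(3)[of "{a, b'}"]) (use cover nes assms in auto)
  ultimately show False
    using R(1,2) by (meson transD)
qed

text \<open>Splitting \<open>b * c\<close> into \<open>b\<close> and \<open>c\<close> gives
  hyperedges around the bridge \<open>{a', b * c}\<close>: the triples of \<open>a'\<close> and of
  \<open>a\<close> share \<open>b\<close>, and the latter shares \<open>a\<close> with
  \<open>{a, b * c}\<close>.\<close>

lemma not_hypertree_three_factors:
  fixes a a' b c :: nat
  assumes co: "coprime a b" "coprime a c" "coprime b c" and "a' dvd a" "a' \<noteq> a" "a' \<noteq> 1" "a > 0" "b > 1" "c > 1"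
    and rad: "\<And>p. prime p \<Longrightarrow> p dvd a \<Longrightarrow> p dvd a'"
  shows "\<not> hypertree (intersection_hypergraph (integer_mod_group (a * b * c)))"
proof
  let ?n = "a * b * c"
  assume tree: "hypertree (intersection_hypergraph (integer_mod_group ?n))"
  have cover: "coprime_cover ?n {x, b * c} \<and> coprime_cover ?n {x, b, c} \<and> b * c \<noteq> x \<and> b \<noteq> x" if "x \<in> {a, a'}" for x
  proof -
    have dvd: "x dvd a" "x \<noteq> 1"
      using that assms by auto
    then have cox: "coprime x b" "coprime x c"
      using co(1,2) coprime_divisors[of x a] by auto
    have dvds: "x dvd ?n" "b dvd ?n" "c dvd ?n" "b * c dvd ?n"
      using dvd(1) by (simp_all add: mult.assoc)
    have prime: "p dvd x \<or> p dvd b \<or> p dvd c" if "prime p" "p dvd ?n" for p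
      using that \<open>x \<in> {a, a'}\<close> rad by (auto simp: prime_dvd_mult_iff)
    have ne: "x \<noteq> b * c" "x \<noteq> b"
      using coprime_neq[OF _ dvd(2), of "b * c"] coprime_neq[OF cox(1) dvd(2)] cox by simp_all
    have "coprime_cover ?n {x, b * c}"
    proof (rule coprime_coverI[of _ _ x "b * c"])
      show "pairwise coprime {x, b * c}"
        using cox by (auto simp: pairwise_insert coprime_commute)
      fix p :: nat assume "prime p" "p dvd ?n"
      then show "\<exists>d\<in>{x, b * c}. p dvd d"
        using prime[of p] by auto
    qed (use ne dvds dvd assms prime in auto)
    moreover have "coprime_cover ?n {x, b, c}"
    proof (rule coprime_coverI[of _ _ x b])
      show "pairwise coprime {x, b, c}"
        using cox co(3) by (auto simp: pairwise_insert coprime_commute)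
    qed (use ne dvds dvd assms prime in auto)
    ultimately show ?thesis
      using ne by simp
  qed
  have nes: "b * c \<noteq> a" "b * c \<noteq> a'" "b \<noteq> a" "b \<noteq> a'" "b * c \<noteq> b" "b * c \<noteq> c"
    using cover[of a] cover[of a'] assms by simp_all
  have "coprime_cover ?n {a', b * c}"
    by (simp add: cover)
  then obtain R where R: "trans R" "(a', b * c) \<notin> R"
    "\<And>A x y. coprime_cover ?n A \<Longrightarrow> \<not> {a', b * c} \<subseteq> A \<Longrightarrow> x \<in> A \<Longrightarrow> y \<in> A \<Longrightarrow> (x, y) \<in> R"
    using coprime_cover_bridge[OF _ tree, of a' "b * c"] assms(7-9) by auto
  have "(a', b) \<in> R"
    by (rule R(3)[of "{a', b, c}"]) (use cover nes assms in auto)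
  moreover have "(b, a) \<in> R"
    by (rule R(3)[of "{a, b, c}"]) (use cover nes assms in auto)
  moreover have "(a, b * c) \<in> R"
    by (rule R(3)[of "{a, b * c}"]) (use cover nes assms in auto)
  ultimately show False
    using R(1,2) by (meson transD)
qed

text \<open>Splitting one or both halves of the bridge \<open>{a * b, c * d}\<close> gives three
  further hyperedges; consecutive ones share \<open>c\<close> and \<open>a\<close>. The factors are
  arbitrary, so one of them may collect several primes.\<close>

lemma not_hypertree_four_factors:
  assumes "a > 1" "b > 1" "c > 1" "d > 1"
    and "coprime a b" "coprime a c" "coprime a d" "coprime b c" "coprime b d" "coprime c d"
  shows "\<not> hypertree (intersection_hypergraph (integer_mod_group (a * b * c * d)))"
proof
  let ?n = "a * b * c * d"
  assume tree: "hypertree (intersection_hypergraph (integer_mod_group ?n))"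
  note co = assms(5-10) assms(5-10)[THEN coprime_commute[THEN iffD1]]
  have abcd: "a * b \<noteq> a" "a * b \<noteq> b" "c * d \<noteq> c" "c * d \<noteq> d"
    using assms(1-4) by auto
  have abc: "a * b \<noteq> c" "a * b \<noteq> d" "c * d \<noteq> a" "c * d \<noteq> b" "a * b \<noteq> c * d"
    using co assms(1-4) by - (rule coprime_neq; simp)+
  have prime: "p dvd a \<or> p dvd b \<or> p dvd c \<or> p dvd d" if "prime p" "p dvd ?n" for p
    using that by (auto simp: prime_dvd_mult_iff)
  have dvd: "a dvd ?n" "b dvd ?n" "c dvd ?n" "d dvd ?n" "a * b dvd ?n" "c * d dvd ?n"
    by (simp_all add: mult.assoc)
  have two: "coprime_cover ?n {a * b, c * d}"
  proof (rule coprime_coverI[of _ _ "a * b" "c * d"])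
    show "pairwise coprime {a * b, c * d}"
      using co by (auto simp: pairwise_insert)
  qed (use dvd assms(1-4) abc in \<open>auto dest!: prime\<close>)
  have three: "coprime_cover ?n {c, d, a * b}" "coprime_cover ?n {a, b, c * d}"
  proof (rule coprime_coverI[of _ _ c "a * b"])
    show "pairwise coprime {c, d, a * b}"
      using co by (auto simp: pairwise_insert)
  next
    show "coprime_cover ?n {a, b, c * d}"
    proof (rule coprime_coverI[of _ _ a "c * d"])
      show "pairwise coprime {a, b, c * d}"
        using co by (auto simp: pairwise_insert)
    qed (use dvd assms(1-4) abc in \<open>auto dest!: prime\<close>)
  qed (use dvd assms(1-4) abc in \<open>auto dest!: prime\<close>)
  have four: "coprime_cover ?n {a, b, c, d}"
  proof (rule coprime_coverI[of _ _ a b])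
    show "a \<noteq> b"
      using assms(1) by (intro coprime_neq[OF assms(5)]) simp
    show "pairwise coprime {a, b, c, d}"
      using co by (auto simp: pairwise_insert)
  qed (use dvd assms(1-4) in \<open>auto dest!: prime\<close>)
  obtain R where R: "trans R" "(a * b, c * d) \<notin> R"
    "\<And>A x y. coprime_cover ?n A \<Longrightarrow> \<not> {a * b, c * d} \<subseteq> A \<Longrightarrow> x \<in> A \<Longrightarrow> y \<in> A \<Longrightarrow> (x, y) \<in> R"
    using coprime_cover_bridge[OF _ tree two] assms(1-4) by auto
  have "(a * b, c) \<in> R"
    by (rule R(3)[OF three(1)]) (use abcd abc in auto)
  moreover have "(c, a) \<in> R"
    by (rule R(3)[OF four]) (use abcd abc in auto)
  moreover have "(a, c * d) \<in> R"
    by (rule R(3)[OF three(2)]) (use abcd abc in auto)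
  ultimately show False
    using R(1,2) by (meson transD)
qed

section \<open>Values with a host tree\<close>

lemma hypertreeI_coprime_divisors:
  fixes depth :: "nat \<Rightarrow> nat"
  assumes "n > 0" "r \<in> coprime_divisors n"
    and "\<And>d. d \<in> coprime_divisors n \<Longrightarrow> d \<noteq> r \<Longrightarrow> par d \<in> coprime_divisors n \<and> depth (par d) < depth d"
    and star: "\<And>A. A \<subseteq> coprime_divisors n \<Longrightarrow> pairwise coprime A \<Longrightarrow>
      (\<And>d. d \<in> coprime_divisors n \<Longrightarrow> \<forall>a \<in> A. coprime a d \<Longrightarrow> d \<in> A) \<Longrightarrow>
      \<exists>c \<in> A. \<forall>a \<in> A - {c}. a \<noteq> r \<and> par a = c"
  shows "hypertree (intersection_hypergraph (integer_mod_group n))"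
proof -
  let ?E = "snd (intersection_hypergraph (integer_mod_group n))"
  have "hypertree (zsub n ` coprime_divisors n, ?E)"
  proof (rule hypertreeI_parent[OF _ assms(2,3)])
    show "inj_on (zsub n) (coprime_divisors n)"
      by (rule inj_on_subset[OF inj_on_zsub[OF assms(1)]]) (auto simp: coprime_divisors_def)
    fix D assume "D \<in> ?E"
    then obtain A where A: "A \<subseteq> coprime_divisors n" "D = zsub n ` A" "pairwise coprime A"
      "\<And>d. d \<in> coprime_divisors n \<Longrightarrow> \<forall>a \<in> A. coprime a d \<Longrightarrow> d \<in> A"
      unfolding hyperedge_integer_mod_group_iff[OF assms(1)] by blast
    then obtain c where "c \<in> A" "\<forall>a \<in> A - {c}. a \<noteq> r \<and> par a = c"
      using star[OF A(1,3,4)] by blast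
    then show "\<exists>A c. D = zsub n ` A \<and> A \<subseteq> coprime_divisors n \<and> c \<in> A \<and> (\<forall>a \<in> A - {c}. a \<noteq> r \<and> par a = c)"
      using A(1,2) by blast
  qed
  moreover have "intersection_hypergraph (integer_mod_group n) = (zsub n ` coprime_divisors n, ?E)"
    by (simp add: intersection_hypergraph_def intersection_vertices_integer_mod_group[OF assms(1)])
  ultimately show ?thesis by simp
qed

text \<open>Every vertex other than \<open>q\<close> is a power of \<open>p\<close>. So
  \<open>q\<close> is coprime to all of them, lies in every hyperedge by maximality, and all
  hyperedges are stars around it.\<close>

lemma hypertree_prime_power_times_prime:
  assumes p: "prime p" and q: "prime q" and "p \<noteq> q" "k \<ge> 1"
  shows "hypertree (intersection_hypergraph (integer_mod_group (p ^ k * q)))"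
proof -
  let ?n = "p ^ k * q" and ?C = "coprime_divisors (p ^ k * q)"
  have pq: "coprime p q"
    using assms primes_coprime by blast
  have np: "\<not> is_unit p" "\<not> is_unit q"
    using p q by (auto dest: not_prime_unit)
  have off: "d = q" if "d dvd ?n" "d \<noteq> 1" "\<not> p dvd d" for d
  proof -
    have "coprime (p ^ k) d"
      using prime_imp_coprime[OF p that(3)] by simp
    then have "d dvd q"
      using that(1) by (simp add: coprime_dvd_mult_right_iff coprime_commute)
    then show ?thesis
      using q that(2) by (auto simp: prime_nat_iff)
  qed
  have C: "p dvd d \<and> coprime d q" if dC: "d \<in> ?C" and "d \<noteq> q" for d
  proof -
    obtain e where e: "e dvd ?n" "e \<noteq> 1" "coprime d e" and d: "d dvd ?n" "d \<noteq> 1"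
      using dC unfolding coprime_divisors_def by blast
    have "p dvd d"
      using off[OF d] \<open>d \<noteq> q\<close> by blast
    \<comment> \<open>The coprime partner \<open>e\<close> has no factor \<open>p\<close>, so it is
      \<open>q\<close> by \<open>off\<close>.\<close>
    then have "\<not> p dvd e"
      using e(3) np(1) coprime_common_divisor by blast
    then show ?thesis
      using off[OF e(1,2)] e(3) \<open>p dvd d\<close> by simp
  qed
  have "p dvd ?n" "p \<noteq> 1" "q \<noteq> 1"
    using \<open>k \<ge> 1\<close> np by (auto simp: dvd_mult2 dvd_power)
  then have qC: "q \<in> ?C"
    using pq unfolding coprime_divisors_def by (auto simp: coprime_commute)
  show ?thesis
  proof (rule hypertreeI_coprime_divisors[OF _ qC, where par = "\<lambda>_. q" and depth = "\<lambda>d. if d = q then 0 else 1"])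
    fix A assume A: "A \<subseteq> ?C" "pairwise coprime A" and
      max: "\<And>d. d \<in> ?C \<Longrightarrow> \<forall>a \<in> A. coprime a d \<Longrightarrow> d \<in> A"
    have "q \<in> A"
    proof (rule ccontr)
      assume "q \<notin> A"
      then have "\<forall>a \<in> A. coprime a q"
        using A(1) C by blast
      then show False
        using max[OF qC] \<open>q \<notin> A\<close> by blast
    qed
    then show "\<exists>c \<in> A. \<forall>a \<in> A - {c}. a \<noteq> q \<and> q = c"
      by blast
  qed (use p q qC in \<open>auto simp: prime_gt_0_nat\<close>)
qed

text \<open>A divisor coprime to a nontrivial divisor misses one of the three primes and so divides
  the product of the other two. Conversely, every listed number is coprime to a prime it
  misses.\<close>

lemma coprime_divisors_three_primes:
  assumes p: "prime p" and q: "prime q" and r: "prime r" and "p \<noteq> q" "p \<noteq> r" "q \<noteq> r"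
  shows "coprime_divisors (p * q * r) = {p, q, r, p * q, p * r, q * r}"
proof (intro equalityI subsetI)
  have two: "d \<in> {x, y, x * y}" if dvd: "d dvd x * y" and xy: "prime x" "prime y" "d \<noteq> 1" for d x y :: nat
  proof -
    obtain b c where d: "d = b * c" "b dvd x" "c dvd y"
      using division_decomp[OF dvd] by blast
    then have "b = 1 \<or> b = x" "c = 1 \<or> c = y"
      using xy(1,2) by (simp_all add: prime_nat_iff)
    then show ?thesis
      using d(1) xy(3) by auto
  qed
  fix d assume "d \<in> coprime_divisors (p * q * r)"
  then obtain e where d: "d dvd p * q * r" "d \<noteq> 1" and e: "e dvd p * q * r" "e \<noteq> 1" "coprime d e"
    unfolding coprime_divisors_def mem_Collect_eq by metis
  obtain s where s: "prime s" "s dvd e"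
    using prime_factor_nat[OF e(2)] by blast
  have "coprime d s"
    using coprime_divisors[OF dvd_refl s(2) e(3)] .
  have "s dvd p * q * r"
    using s(2) e(1) by (rule dvd_trans)
  then have "s = p \<or> s = q \<or> s = r"
    using s(1) p q r by (auto simp: prime_dvd_mult_iff primes_dvd_imp_eq)
  then have "d dvd q * r \<or> d dvd p * r \<or> d dvd p * q"
  proof (elim disjE)
    assume "s = p"
    have "d dvd p * (q * r)" using d(1) by (simp add: mult.assoc)
    then show ?thesis using \<open>coprime d s\<close> \<open>s = p\<close> by (simp add: coprime_dvd_mult_right_iff)
  next
    assume "s = q"
    have "d dvd q * (p * r)" using d(1) by (simp add: ac_simps)
    then show ?thesis using \<open>coprime d s\<close> \<open>s = q\<close> by (simp add: coprime_dvd_mult_right_iff)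
  next
    assume "s = r"
    have "d dvd r * (p * q)" using d(1) by (simp add: ac_simps)
    then show ?thesis using \<open>coprime d s\<close> \<open>s = r\<close> by (simp add: coprime_dvd_mult_right_iff)
  qed
  then show "d \<in> {p, q, r, p * q, p * r, q * r}"
    using two[of d q r] two[of d p r] two[of d p q] p q r d(2) by auto
next
  let ?n = "p * q * r"
  have ne: "p \<noteq> 1" "q \<noteq> 1" "r \<noteq> 1"
    using p q r by auto
  have co: "coprime p q" "coprime p r" "coprime q r"
    using assms by (simp_all add: primes_coprime)
  have I: "x \<in> coprime_divisors ?n" if "x dvd ?n" "x \<noteq> 1" "y dvd ?n" "y \<noteq> 1" "coprime x y" for x y
    unfolding coprime_divisors_def using that by blast
  have dvds: "p dvd ?n" "q dvd ?n" "r dvd ?n" "p * q dvd ?n" "p * r dvd ?n" "q * r dvd ?n"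
    by (simp_all add: mult.assoc)
  have "p \<in> coprime_divisors ?n" "q \<in> coprime_divisors ?n" "r \<in> coprime_divisors ?n"
    using I[of p q] I[of q r] I[of r p] dvds ne co by (simp_all add: coprime_commute)
  moreover have "p * q \<in> coprime_divisors ?n" "p * r \<in> coprime_divisors ?n" "q * r \<in> coprime_divisors ?n"
    using I[of "p * q" r] I[of "p * r" q] I[of "q * r" p] dvds ne co by (simp_all add: coprime_commute)
  moreover fix d assume "d \<in> {p, q, r, p * q, p * r, q * r}"
  ultimately show "d \<in> coprime_divisors ?n" by auto
qed

text \<open>The hyperedges are \<open>{p, q, r}\<close>, \<open>{p * q, r}\<close>,
  \<open>{p * r, q}\<close> and \<open>{q * r, p}\<close>; in the tree given by \<open>par\<close>
  they are stars with centres \<open>q\<close>, \<open>r\<close>, \<open>q\<close> and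
  \<open>p\<close>.\<close>

lemma hypertree_three_primes:
  assumes p: "prime p" and q: "prime q" and r: "prime r" and ne: "p \<noteq> q" "p \<noteq> r" "q \<noteq> r"
  shows "hypertree (intersection_hypergraph (integer_mod_group (p * q * r)))"
proof -
  let ?C = "coprime_divisors (p * q * r)"
  have C: "?C = {p, q, r, p * q, p * r, q * r}"
    using coprime_divisors_three_primes[OF assms] .
  have gt: "p > 1" "q > 1" "r > 1"
    using p q r prime_gt_1_nat by auto
  have co: "coprime p q" "coprime p r" "coprime q r" "coprime q p" "coprime r p" "coprime r q"
    using assms by (simp_all add: primes_coprime)
  have nco: "\<not> coprime p p" "\<not> coprime q q" "\<not> coprime r r"
    using gt by auto
  have pne: "x * y \<noteq> z" if "prime z" "x > 1" "y > 1" for x y z :: nat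
    using that prime_product[of x y] by auto
  have nes: "p * q \<noteq> p" "p * q \<noteq> q" "p * q \<noteq> r" "p * r \<noteq> p" "p * r \<noteq> q" "p * r \<noteq> r"
    "q * r \<noteq> p" "q * r \<noteq> q" "q * r \<noteq> r"
    using p q r gt by (simp_all add: pne)
  have nes2: "p * q \<noteq> p * r" "p * q \<noteq> q * r" "p * r \<noteq> q * r"
    using ne gt by auto
  define par where "par d = (if d = q * r then p else if d = p * q then r else q)" for d
  define depth :: "nat \<Rightarrow> nat" where "depth d = (if d = q then 0 else if d = q * r \<or> d = p * q then 2 else 1)" for d
  show ?thesis
  proof (rule hypertreeI_coprime_divisors[where r = q and par = par and depth = depth])
    show "p * q * r > 0" using gt by simp
    show "q \<in> ?C" by (simp add: C)
    show "par d \<in> ?C \<and> depth (par d) < depth d" if "d \<in> ?C" "d \<noteq> q" for d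
      using that ne nes nes2 unfolding C par_def depth_def by auto
    fix A assume A: "A \<subseteq> ?C" "pairwise coprime A" and
      max: "\<And>d. d \<in> ?C \<Longrightarrow> \<forall>a \<in> A. coprime a d \<Longrightarrow> d \<in> A"
    \<comment> \<open>Applied to a product \<open>m\<close> of two of the primes: the third prime
      \<open>z\<close> is the only vertex coprime to it, so a maximal set containing
      \<open>m\<close> consists of \<open>m\<close> and \<open>z\<close>.\<close>
    have pair: "z \<in> A \<and> A \<subseteq> {m, z}"
      if "m \<in> A" "z \<in> ?C" "coprime m z" and only: "\<And>d. d \<in> ?C \<Longrightarrow> coprime d m \<Longrightarrow> d = z" for m z
    proof -
      have sub: "A \<subseteq> {m, z}"
      proof
        fix a assume a: "a \<in> A"
        show "a \<in> {m, z}"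
        proof (cases "a = m")
          case False
          then have "coprime a m"
            using A(2) a that(1) by (simp add: pairwise_def)
          then show ?thesis
            using only[of a] a A(1) by blast
        qed simp
      qed
      have "z \<in> A"
      proof (rule ccontr)
        assume "z \<notin> A"
        then have "A \<subseteq> {m}" using sub by blast
        then show False
          using max[OF that(2)] that(3) \<open>z \<notin> A\<close> by blast
      qed
      then show ?thesis using sub by simp
    qed
    consider "p * q \<in> A" | "p * r \<in> A" | "q * r \<in> A" | "A \<subseteq> {p, q, r}"
      using A(1) unfolding C by blast
    then show "\<exists>c \<in> A. \<forall>a \<in> A - {c}. a \<noteq> q \<and> par a = c"
    proof cases
      case 1
      have "r \<in> A \<and> A \<subseteq> {p * q, r}"
      proof (rule pair[OF 1])
        show "d = r" if "d \<in> ?C" "coprime d (p * q)" for d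
          using that nco unfolding C by auto
      qed (use co in \<open>simp_all add: C\<close>)
      then show ?thesis
        using nes nes2 by (intro bexI[of _ r]) (auto simp: par_def)
    next
      case 2
      have "q \<in> A \<and> A \<subseteq> {p * r, q}"
      proof (rule pair[OF 2])
        show "d = q" if "d \<in> ?C" "coprime d (p * r)" for d
          using that nco unfolding C by auto
      qed (use co in \<open>simp_all add: C\<close>)
      then show ?thesis
        using nes nes2 by (intro bexI[of _ q]) (auto simp: par_def)
    next
      case 3
      have "p \<in> A \<and> A \<subseteq> {q * r, p}"
      proof (rule pair[OF 3])
        show "d = p" if "d \<in> ?C" "coprime d (q * r)" for d
          using that nco unfolding C by auto
      qed (use co in \<open>simp_all add: C\<close>)
      then show ?thesis
        using nes nes2 by (intro bexI[of _ p]) (auto simp: par_def)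
    next
      case 4
      have "q \<in> A"
      proof (rule ccontr)
        assume "q \<notin> A"
        then have "\<forall>a \<in> A. coprime a q"
          using 4 co by blast
        then show False
          using max[of q] \<open>q \<notin> A\<close> by (simp add: C)
      qed
      moreover have "par p = q" "par r = q"
        using nes by (auto simp: par_def)
      ultimately show ?thesis
        using 4 by (intro bexI[of _ q]) auto
    qed
  qed
qed

section \<open>Splitting off prime powers\<close>

text \<open>Taking the full power of a prime factor makes the cofactor coprime to it, so the
  splitting can be repeated on the cofactor.\<close>

lemma prime_power_cofactor:
  fixes n :: nat
  assumes "n > 1"
  obtains p k m where "prime p" "k \<ge> 1" "n = p ^ k * m" "coprime p m" "m > 0"
proof -
  obtain p where p: "prime p" "p dvd n"
    using prime_factor_nat[of n] assms by auto
  have "finite {k. p ^ k dvd n}" "n \<noteq> 0" "\<not> is_unit p"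
    using assms p by (auto intro!: finite_divisor_powers dest: not_prime_unit)
  then obtain m where m: "n = p ^ multiplicity p n * m" "\<not> p dvd m"
    by (metis multiplicity_decompose')
  show thesis
  proof
    show "prime p" "n = p ^ multiplicity p n * m"
      using p m by auto
    show "1 \<le> multiplicity p n"
      using p \<open>n \<noteq> 0\<close> prime_multiplicity_gt_zero_iff[of p n] by auto
    show "coprime p m"
      using prime_imp_coprime[OF p(1) m(2)] .
    show "m > 0" using m(1) \<open>n \<noteq> 0\<close> by (intro gr0I) simp
  qed
qed

lemma prime_power_gt_1: "prime p \<Longrightarrow> k \<ge> 1 \<Longrightarrow> p ^ k > 1" for p k :: nat
  using one_less_power[of p k] prime_gt_1_nat[of p] by simp

text \<open>For exponents of at least two, \<open>p\<close> itself is the proper divisor of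
  \<open>p ^ k\<close> with the same primes that the obstructions ask for.\<close>

lemma proper_radical:
  fixes p k :: nat
  assumes "prime p" "k \<noteq> 1" "k \<ge> 1"
  shows "p dvd p ^ k" "p \<noteq> p ^ k" "p \<noteq> 1" "\<And>s. prime s \<Longrightarrow> s dvd p ^ k \<Longrightarrow> s dvd p"
proof -
  show "p dvd p ^ k" "p \<noteq> 1"
    using assms by (auto simp: dvd_power)
  show "p \<noteq> p ^ k"
    using power_inject_exp[of p 1 k] prime_gt_1_nat[OF assms(1)] assms(2) by auto
qed (rule prime_dvd_power)

section \<open>Case distinction on the number of prime factors of \<open>n\<close>\<close>

theorem theorem3p7:
  fixes n :: nat
  assumes "n > 0" and "card (prime_factors n) \<ge> 2"
  shows "hypertree (intersection_hypergraph (integer_mod_group n)) \<longleftrightarrow>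
    (\<exists>p\<^sub>1 p\<^sub>2 \<alpha>\<^sub>1 :: nat. prime p\<^sub>1 \<and> prime p\<^sub>2 \<and> p\<^sub>1 \<noteq> p\<^sub>2 \<and> \<alpha>\<^sub>1 \<ge> 1 \<and> n = p\<^sub>1 ^ \<alpha>\<^sub>1 * p\<^sub>2) \<or>
    (\<exists>p\<^sub>1 p\<^sub>2 p\<^sub>3 :: nat. prime p\<^sub>1 \<and> prime p\<^sub>2 \<and> prime p\<^sub>3 \<and>
       p\<^sub>1 \<noteq> p\<^sub>2 \<and> p\<^sub>1 \<noteq> p\<^sub>3 \<and> p\<^sub>2 \<noteq> p\<^sub>3 \<and> n = p\<^sub>1 * p\<^sub>2 * p\<^sub>3)"
    (is "?tree \<longleftrightarrow> ?two \<or> ?three")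
proof
  assume tree: ?tree
  have "n > 1"
    using assms by (cases "n = 1") auto
  then obtain p i m where p: "prime p" "i \<ge> 1" "n = p ^ i * m" "coprime p m" "m > 0"
    using prime_power_cofactor by metis
  have "m \<noteq> 1"
  proof
    assume "m = 1"
    then have "prime_factors n \<subseteq> {p}"
    proof (intro subsetI)
      fix s assume "s \<in> prime_factors n"
      then have s: "prime s" "s dvd p ^ i"
        using p(3) \<open>m = 1\<close> by (simp_all add: in_prime_factors_iff)
      then have "s dvd p"
        using prime_dvd_power by blast
      then show "s \<in> {p}"
        using primes_dvd_imp_eq[OF s(1) p(1)] by simp
    qed
    then have "card (prime_factors n) \<le> card {p}"
      by (rule card_mono[rotated]) simp
    then show False
      using assms(2) by simp
  qed
  then have "m > 1" using p(5) by simp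
  then obtain q j m' where q: "prime q" "j \<ge> 1" "m = q ^ j * m'" "coprime q m'" "m' > 0"
    using prime_power_cofactor by metis
  have pq: "coprime p q" "coprime p m'"
    using p(4) q(2,3) by (auto simp: coprime_mult_right_iff)
  have "p \<noteq> q" using pq(1) p(1) by auto
  show "?two \<or> ?three"
  proof (cases "m' = 1")
    case True
    then have n: "n = p ^ i * q ^ j" using p q by simp
    have "i = 1 \<or> j = 1"
    proof (rule ccontr)
      assume "\<not> (i = 1 \<or> j = 1)"
      then have "\<not> ?tree" unfolding n
        using proper_radical[OF p(1) _ p(2)] proper_radical[OF q(1) _ q(2)] pq(1) prime_gt_0_nat[OF p(1)] prime_gt_0_nat[OF q(1)]
        by (intro not_hypertree_two_factors[where a' = p and b' = q]) simp_all
      then show False using tree by blast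
    qed
    then have ?two
    proof
      \<comment> \<open>Here the roles are exchanged: \<open>q\<close>, with exponent
        \<open>j\<close>, is the prime that may be repeated.\<close>
      assume "i = 1"
      then show ?thesis
        using n p q \<open>p \<noteq> q\<close> by (intro exI[of _ q] exI[of _ p] exI[of _ j]) (simp add: mult.commute)
    next
      assume "j = 1"
      then show ?thesis
        using n p q \<open>p \<noteq> q\<close> by (intro exI[of _ p] exI[of _ q] exI[of _ i]) simp
    qed
    then show ?thesis ..
  next
    case False
    then have "m' > 1" using q(5) by simp
    then obtain r k m'' where r: "prime r" "k \<ge> 1" "m' = r ^ k * m''" "coprime r m''" "m'' > 0"
      using prime_power_cofactor by metis
    have co: "coprime p r" "coprime p m''" "coprime q r" "coprime q m''"
      using pq(2) q(4) r(2,3) by (auto simp: coprime_mult_right_iff)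
    have n: "n = p ^ i * q ^ j * r ^ k * m''"
      using p(3) q(3) r(3) by (simp add: mult.assoc)
    have gt: "p ^ i > 1" "q ^ j > 1" "r ^ k > 1"
      using prime_power_gt_1[OF p(1,2)] prime_power_gt_1[OF q(1,2)] prime_power_gt_1[OF r(1,2)] .
    \<comment> \<open>\<open>m''\<close> collects all primes beyond the first three; if nontrivial,
      it serves as the fourth factor.\<close>
    have "m'' = 1"
    proof (rule ccontr)
      assume "m'' \<noteq> 1"
      then have "\<not> ?tree" unfolding n
        using gt r(4,5) co pq by (intro not_hypertree_four_factors) simp_all
      then show False using tree by blast
    qed
    \<comment> \<open>The obstruction concerns the exponent of the first factor, so the claim is
      stated for arbitrary primes and then used with each of \<open>p\<close>, \<open>q\<close>,
      \<open>r\<close> in first place.\<close>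
    have one: "a = 1" if x: "prime x" "prime y" "prime z" "a \<ge> 1" "b \<ge> 1" "c \<ge> 1" "n = x ^ a * y ^ b * z ^ c"
      "coprime x y" "coprime x z" "coprime y z" for x y z a b c
    proof (rule ccontr)
      assume "a \<noteq> 1"
      have "x ^ a > 0"
        using prime_gt_0_nat[OF x(1)] by simp
      then have "\<not> ?tree" unfolding x(7)
        using proper_radical[OF x(1) \<open>a \<noteq> 1\<close> x(4)] \<open>x ^ a > 0\<close> x(8-10)
          prime_power_gt_1[OF x(2,5)] prime_power_gt_1[OF x(3,6)]
        by (intro not_hypertree_three_factors[where a' = x]) simp_all
      then show False using tree by blast
    qed
    have "i = 1" "j = 1" "k = 1"
      using one[of p q r i j k] one[of q p r j i k] one[of r p q k i j] p(1,2) q(1,2) r(1,2) co pq n \<open>m'' = 1\<close>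
      by (simp_all add: coprime_commute ac_simps)
    moreover have "p \<noteq> r" "q \<noteq> r"
      using co(1,3) p(1) q(1) by auto
    ultimately have ?three
      using n \<open>m'' = 1\<close> p(1) q(1) r(1) \<open>p \<noteq> q\<close> by (intro exI[of _ p] exI[of _ q] exI[of _ r]) simp
    then show ?thesis ..
  qed
next
  assume "?two \<or> ?three"
  then show ?tree
    using hypertree_prime_power_times_prime hypertree_three_primes by blast
qed

end
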